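(* Let $q=p^m$ with $p$ prime, let $T,\theta$ be functions such that $G=\{\mathfrak{g}_{a,b,c}\}$ is closed under $\circ$ and some $\theta_{a,b,c}$ is nontrivial, and let $g_2\in\mathrm{Aut}(\mathbb{F}_q)$ have order $p$. If $r_A\le1$, then there exists $\mu_A\in\mathbb{F}_q$ with $g_2(\mu_A)=\mu_A$ and $\theta_{x,0,0}=g_2^{\mathrm{tr}_{\mathbb{F}_q/\mathbb{F}_p}(\mu_Ax)}$ for all $x\in\mathbb{F}_q$. Likewise, if $r_B\le1$, there exists $\mu_B\in\mathbb{F}_q$ with $g_2(\mu_B)=\mu_B$ and $\theta_{0,x,0}=g_2^{\mathrm{tr}_{\mathbb{F}_q/\mathbb{F}_p}(\mu_Bx)}$ for all $x\in\mathbb{F}_q$.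
   Context: $T:\mathbb{F}_q^3\to\mathbb{F}_q$, $\theta:\mathbb{F}_q^3\to\mathrm{Aut}(\mathbb{F}_q)$, $\theta_{a,b,c}=\theta(a,b,c)$. $E(a,b,c,t)$ is the matrix with rows $(1,0,0,0),(-c,1,0,0),(b-ct,t,1,0),(a,b,c,1)$; $\mathfrak{g}_{a,b,c}=(E(a,b,c,T(a,b,c)),\theta_{a,b,c})$ with product $(A_1,\sigma_1)\circ(A_2,\sigma_2)=(A_1^{\sigma_2}A_2,\sigma_1\sigma_2)$; $G=\{\mathfrak{g}_{a,b,c}\}$. $\psi:\mathfrak{g}_{a,b,c}\mapsto\theta_{a,b,c}$. $p^{r_A}$ (resp. $p^{r_B}$) is the exponent of $\psi(G_A)$ (resp. $\psi(G_B)$), where $G_A=\{\mathfrak{g}_{a,0,0}\}$, $G_B=\{\mathfrak{g}_{0,b,0}\}$. $\mathrm{tr}_{\mathbb{F}_q/\mathbb{F}_p}(x)=\sum_{i=0}^{m-1}x^{p^i}$. *)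

theory Defs
  imports
    "HOL-Analysis.Cartesian_Space"
    "HOL-Algebra.Multiplicative_Group"
    "HOL-Computational_Algebra.Primes"
begin

text \<open>
  The product is written for the right action \<open>x\<^sup>\<sigma> = \<sigma> x\<close>, so that
  \<open>x\<^bsup>\<sigma>\<tau>\<^esup> = (x\<^sup>\<sigma>)\<^sup>\<tau>\<close>, that is, \<open>\<sigma>\<tau> = \<tau> \<circ> \<sigma>\<close>. For a finite field the group is
  commutative and the order is immaterial.
\<close>

definition field_Aut :: "('a::field \<Rightarrow> 'a) monoid" where
  "field_Aut =
     \<lparr>carrier = {\<sigma>. bij \<sigma> \<and> \<sigma> 1 = 1 \<and> (\<forall>x y. \<sigma> (x + y) = \<sigma> x + \<sigma> y) \<and>
                    (\<forall>x y. \<sigma> (x * y) = \<sigma> x * \<sigma> y)},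
      monoid.mult = (\<lambda>\<sigma> \<tau>. \<tau> \<circ> \<sigma>),
      one = id\<rparr>"

lemma group_field_Aut: "group (field_Aut :: ('a::field \<Rightarrow> 'a) monoid)"
proof (rule groupI)
  fix \<sigma> :: "'a \<Rightarrow> 'a"
  assume \<sigma>: "\<sigma> \<in> carrier field_Aut"
  then have b: "bij \<sigma>" and one: "\<sigma> 1 = 1"
    and add: "\<And>x y. \<sigma> (x + y) = \<sigma> x + \<sigma> y" and mult: "\<And>x y. \<sigma> (x * y) = \<sigma> x * \<sigma> y"
    by (auto simp: field_Aut_def)
  have s: "\<sigma> (inv_into UNIV \<sigma> x) = x" for x
    using b by (simp add: bij_is_surj surj_f_inv_f)
  have i: "inv_into UNIV \<sigma> (\<sigma> x) = x" for x
    using b by (simp add: bij_is_inj)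
  have "inv_into UNIV \<sigma> \<in> carrier field_Aut"
    unfolding field_Aut_def
    using bij_imp_bij_inv[OF b] i[of 1] one
    by (auto simp: add mult s) (metis add i s, metis mult i s)
  moreover have "inv_into UNIV \<sigma> \<otimes>\<^bsub>field_Aut\<^esub> \<sigma> = \<one>\<^bsub>field_Aut\<^esub>"
    using s by (auto simp: field_Aut_def)
  ultimately show "\<exists>\<tau>\<in>carrier field_Aut. \<tau> \<otimes>\<^bsub>field_Aut\<^esub> \<sigma> = \<one>\<^bsub>field_Aut\<^esub>"
    by blast
qed (auto simp: field_Aut_def bij_comp comp_assoc)

definition group_exponent :: "('g, 'x) monoid_scheme \<Rightarrow> 'g set \<Rightarrow> nat" where
  "group_exponent \<G> H = (LEAST n. n > 0 \<and> (\<forall>h\<in>H. h [^]\<^bsub>\<G>\<^esub> n = \<one>\<^bsub>\<G>\<^esub>))"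

definition E_mat :: "'a::field \<Rightarrow> 'a \<Rightarrow> 'a \<Rightarrow> 'a \<Rightarrow> 'a^4^4" where
  "E_mat a b c t = vector
     [vector [1,         0, 0, 0],
      vector [- c,       1, 0, 0],
      vector [b - c * t, t, 1, 0],
      vector [a,         b, c, 1]]"

definition semi_mult ::
  "('a::field^4^4) \<times> ('a \<Rightarrow> 'a) \<Rightarrow> ('a^4^4) \<times> ('a \<Rightarrow> 'a) \<Rightarrow> ('a^4^4) \<times> ('a \<Rightarrow> 'a)"
  (infixl "\<circ>\<^sub>s" 70) where
  "g \<circ>\<^sub>s h = (map_matrix (snd h) (fst g) ** fst h, snd g \<otimes>\<^bsub>field_Aut\<^esub> snd h)"

definition g_elem ::
  "('a::field \<Rightarrow> 'a \<Rightarrow> 'a \<Rightarrow> 'a) \<Rightarrow> ('a \<Rightarrow> 'a \<Rightarrow> 'a \<Rightarrow> 'a \<Rightarrow> 'a) \<Rightarrow> 'a \<Rightarrow> 'a \<Rightarrow> 'a \<Rightarrow> ('a^4^4) \<times> ('a \<Rightarrow> 'a)" where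
  "g_elem T \<theta> a b c = (E_mat a b c (T a b c), \<theta> a b c)"

definition G_set ::
  "('a::field \<Rightarrow> 'a \<Rightarrow> 'a \<Rightarrow> 'a) \<Rightarrow> ('a \<Rightarrow> 'a \<Rightarrow> 'a \<Rightarrow> 'a \<Rightarrow> 'a) \<Rightarrow> (('a^4^4) \<times> ('a \<Rightarrow> 'a)) set" where
  "G_set T \<theta> = {g_elem T \<theta> a b c | a b c. True}"

definition G_A ::
  "('a::field \<Rightarrow> 'a \<Rightarrow> 'a \<Rightarrow> 'a) \<Rightarrow> ('a \<Rightarrow> 'a \<Rightarrow> 'a \<Rightarrow> 'a \<Rightarrow> 'a) \<Rightarrow> (('a^4^4) \<times> ('a \<Rightarrow> 'a)) set" where
  "G_A T \<theta> = {g_elem T \<theta> a 0 0 | a. True}"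

definition G_B ::
  "('a::field \<Rightarrow> 'a \<Rightarrow> 'a \<Rightarrow> 'a) \<Rightarrow> ('a \<Rightarrow> 'a \<Rightarrow> 'a \<Rightarrow> 'a \<Rightarrow> 'a) \<Rightarrow> (('a^4^4) \<times> ('a \<Rightarrow> 'a)) set" where
  "G_B T \<theta> = {g_elem T \<theta> 0 b 0 | b. True}"

definition psi :: "('a::field^4^4) \<times> ('a \<Rightarrow> 'a) \<Rightarrow> ('a \<Rightarrow> 'a)" where
  "psi g = snd g"

text \<open>
  The number \<open>r\<close> with \<open>p\<^sup>r\<close> the exponent of \<open>\<psi>(H)\<close>. It exists for \<open>H = G_A\<close> and \<open>H = G_B\<close>
  as soon as \<open>G\<close> is closed under the product, these being then \<open>p\<close>-groups of order \<open>q\<close>.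
\<close>

definition exponent_log :: "nat \<Rightarrow> (('a::field^4^4) \<times> ('a \<Rightarrow> 'a)) set \<Rightarrow> nat" where
  "exponent_log p H = (THE r. p ^ r = group_exponent field_Aut (psi ` H))"

definition field_tr :: "nat \<Rightarrow> nat \<Rightarrow> 'a::field \<Rightarrow> 'a" where
  "field_tr p m x = (\<Sum>i<m. x ^ (p ^ i))"

text \<open>
  An element of the prime field, such as a value of the trace, is turned into an exponent by
  taking its representative in \<open>{0..<p}\<close>; a power of an element of order \<open>p\<close> does not depend on
  the choice of representative.
\<close>

definition prime_field_rep :: "'a::field \<Rightarrow> nat" where
  "prime_field_rep x = (THE k. k < CHAR('a) \<and> of_nat k = x)"

end

theory Submission
  imports Defs "HOL-Number_Theory.Residues" "HOL-Computational_Algebra.Polynomial"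
begin

text \<open>
  On the subgroups \<open>G_A\<close> and \<open>G_B\<close> closure amounts to \<open>\<theta> (x\<^bsup>\<theta> y\<^esup> + y) = \<theta> x \<cdot> \<theta> y\<close>, that is, \<open>\<theta>\<close>
  is a homomorphism for a twisted addition on the field. If its image has exponent at most \<open>p\<close>,
  it lies in \<open>\<langle>g\<^sub>2\<rangle>\<close>, because the automorphism group is cyclic. Its kernel is then an additive
  subgroup of index at most \<open>p\<close> that is stable under \<open>g\<^sub>2\<close>, and \<open>g\<^sub>2\<close>, having order \<open>p\<close>, acts
  trivially on the quotient. Hence \<open>\<theta>\<close> is additive and invariant under \<open>g\<^sub>2\<close>, so its exponent is
  \<open>tr (\<mu> x)\<close> for a unique \<open>\<mu>\<close>, and uniqueness makes \<open>\<mu>\<close> fixed by \<open>g\<^sub>2\<close>.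
\<close>

section \<open>Finite fields and the trace\<close>

lemma prime_CHAR: "prime CHAR('a::finite_field)"
  by (rule prime_CHAR_semidom) (use CHAR_pos in auto)

lemma CHAR_eq_if_CARD_eq_prime_power:
  assumes "prime p" "CARD('a::finite_field) = p ^ m"
  shows "CHAR('a) = p"
proof -
  have "CHAR('a) dvd p ^ m"
    using CHAR_dvd_CARD[where 'a = 'a] assms(2) by simp
  then have "CHAR('a) dvd p"
    using prime_dvd_power prime_CHAR by blast
  then show ?thesis
    using assms(1) prime_CHAR primes_dvd_imp_eq by blast
qed

section \<open>The prime field as the fixed points of the Frobenius map\<close>

lemma of_nat_power_CHAR: "(of_nat k :: 'a::finite_field) ^ CHAR('a) = of_nat k"
proof (induction k)
  case (Suc k)
  then show ?case
    using freshmans_dream[of "CHAR('a)" "1 :: 'a" "of_nat k"] prime_CHAR by simp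
qed (simp add: CHAR_pos)

text \<open>The polynomial \<open>P\<close> has at most \<open>?p\<close> roots, and the
  \<open>?p\<close> distinct elements \<open>of_nat k\<close> with \<open>k < ?p\<close> already are
  roots.\<close>

lemma power_CHAR_eq_self_imp_of_nat:
  fixes x :: "'a::finite_field"
  assumes "x ^ CHAR('a) = x"
  shows "\<exists>k<CHAR('a). x = of_nat k"
proof -
  let ?p = "CHAR('a)"
  define P :: "'a poly" where "P = Polynomial.monom 1 ?p - Polynomial.monom 1 1"
  have p1: "?p > 1"
    using prime_CHAR prime_gt_1_nat by blast
  have c: "coeff P ?p = 1"
    using p1 by (simp add: P_def)
  then have "P \<noteq> 0" by auto
  have "degree P \<le> ?p"
    unfolding P_def using p1
    by (intro degree_diff_le) (auto intro: order_trans[OF degree_monom_le])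
  with card_poly_roots_bound[OF \<open>P \<noteq> 0\<close>] have le: "card {x. poly P x = 0} \<le> ?p"
    by linarith
  have ev: "poly P x = 0 \<longleftrightarrow> x ^ ?p = x" for x
    by (simp add: P_def poly_monom)
  have inj: "inj_on (of_nat :: nat \<Rightarrow> 'a) {..<?p}"
    by (auto simp: inj_on_def of_nat_eq_iff_cong_CHAR cong_less_modulus_unique_nat)
  have "of_nat ` {..<?p} = {x. poly P x = 0}"
  proof (rule card_seteq)
    show "of_nat ` {..<?p} \<subseteq> {x. poly P x = 0}"
      by (auto simp: ev of_nat_power_CHAR)
    show "card {x. poly P x = 0} \<le> card ((of_nat :: nat \<Rightarrow> 'a) ` {..<?p})"
      using le by (simp add: card_image[OF inj])
  qed simp
  then show ?thesis
    using assms ev by blast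
qed

lemma prime_field_rep_of_nat:
  "prime_field_rep (of_nat k :: 'a::finite_field) = k mod CHAR('a)"
proof -
  have "CHAR('a) > 0" using CHAR_pos by auto
  then show ?thesis
    unfolding prime_field_rep_def
    by (intro the_equality)
      (auto simp: of_nat_eq_iff_cong_CHAR cong_def)
qed

lemma of_nat_prime_field_rep:
  fixes x :: "'a::finite_field"
  assumes "x ^ CHAR('a) = x"
  shows "of_nat (prime_field_rep x) = x"
  using power_CHAR_eq_self_imp_of_nat[OF assms] by (auto simp: prime_field_rep_of_nat)

section \<open>The trace to the prime field\<close>

lemma field_tr_add:
  "field_tr CHAR('a) m (x + y) = field_tr CHAR('a) m x + field_tr CHAR('a) m (y :: 'a::finite_field)"
  by (simp add: field_tr_def freshmans_dream'[OF prime_CHAR refl] sum.distrib)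

lemma field_tr_0 [simp]: "field_tr CHAR('a) m (0 :: 'a::finite_field) = 0"
  using field_tr_add[of m "0::'a" 0] by (metis add_0 add_cancel_left_left)

lemma field_tr_power_CHAR:
  fixes x :: "'a::finite_field"
  assumes "CARD('a) = CHAR('a) ^ m"
  shows "field_tr CHAR('a) m x ^ CHAR('a) = field_tr CHAR('a) m x"
proof -
  have "field_tr CHAR('a) m x ^ CHAR('a) = (\<Sum>i<m. x ^ (CHAR('a) ^ Suc i))"
    by (simp add: field_tr_def freshmans_dream_sum[OF prime_CHAR refl] mult.commute flip: power_mult)
  \<comment> \<open>Both sums are the sum over \<open>i < Suc m\<close> less one end term; the end
    terms at \<open>i = 0\<close> and \<open>i = m\<close> agree, since \<open>x\<close> raised to
    the field size is \<open>x\<close>.\<close>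
  also have "\<dots> = (\<Sum>i<m. x ^ (CHAR('a) ^ i))"
    using sum.lessThan_Suc_shift[of "\<lambda>i. x ^ (CHAR('a) ^ i)" m]
      finite_field_power_card_eq_same[of x] assms
    by simp
  finally show ?thesis by (simp add: field_tr_def)
qed

text \<open>As a polynomial in \<open>x\<close> the trace is nonzero of degree at most
  \<open>?p ^ (m - 1)\<close>, too small for every field element to be a root.\<close>

lemma field_tr_nonzero:
  assumes "CARD('a::finite_field) = CHAR('a) ^ m"
  shows "\<exists>x::'a. field_tr CHAR('a) m x \<noteq> 0"
proof (rule ccontr)
  assume "\<not> ?thesis"
  then have z: "field_tr CHAR('a) m x = 0" for x :: 'a by blast
  let ?p = "CHAR('a)"
  have p1: "?p > 1"
    using prime_CHAR prime_gt_1_nat by blast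
  \<comment> \<open>A field has at least two elements, so \<open>m\<close> is positive and
    \<open>m - 1\<close> is a genuine index, not a truncated difference.\<close>
  have "card {0, 1 :: 'a} \<le> CARD('a)"
    by (rule card_mono) auto
  then have m: "m > 0" using assms by (cases m) auto
  define P :: "'a poly" where "P = (\<Sum>i<m. Polynomial.monom 1 (?p ^ i))"
  have "coeff P (?p ^ (m - 1)) = (\<Sum>i<m. if i = m - 1 then 1 else 0)"
    unfolding P_def coeff_sum using p1 by (intro sum.cong) auto
  then have "P \<noteq> 0" using m by auto
  have "degree P \<le> ?p ^ (m - 1)"
    unfolding P_def using p1
    by (intro degree_sum_le) (auto intro!: order_trans[OF degree_monom_le] power_increasing)
  moreover have "{x. poly P x = 0} = UNIV"
    using z by (auto simp: P_def poly_sum poly_monom field_tr_def)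
  ultimately have "?p ^ m \<le> ?p ^ (m - 1)"
    using card_poly_roots_bound[OF \<open>P \<noteq> 0\<close>] assms by simp
  then show False
    using p1 m by (simp add: power_increasing_iff)
qed

lemma field_tr_mult_nondegenerate:
  fixes y :: "'a::finite_field"
  assumes "CARD('a) = CHAR('a) ^ m" "\<And>x. field_tr CHAR('a) m (y * x) = 0"
  shows "y = 0"
proof (rule ccontr)
  assume "y \<noteq> 0"
  then have "field_tr CHAR('a) m x = 0" for x :: 'a
    using assms(2)[of "x / y"] by simp
  then show False using field_tr_nonzero[OF assms(1)] by blast
qed

lemma sum_nontrivial_character:
  fixes \<phi> :: "'a::{ab_group_add,finite} \<Rightarrow> complex"
  assumes "\<And>x y. \<phi> (x + y) = \<phi> x * \<phi> y" "\<phi> a \<noteq> 1"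
  shows "(\<Sum>x\<in>UNIV. \<phi> x) = 0"
proof -
  \<comment> \<open>Translation by \<open>a\<close> permutes the summands and multiplies the sum by
    \<open>\<phi> a\<close>, which is not 1.\<close>
  have "(\<Sum>x\<in>UNIV. \<phi> x) = (\<Sum>x\<in>UNIV. \<phi> (x + a))"
    by (rule sum.reindex_bij_witness[of _ "\<lambda>x. x + a" "\<lambda>x. x - a"]) auto
  also have "\<dots> = (\<Sum>x\<in>UNIV. \<phi> x) * \<phi> a"
    by (simp add: assms(1) sum_distrib_right)
  finally show ?thesis using assms(2) by simp
qed

text \<open>The standard embedding of the prime field into the complex roots of unity. It is meant
  for fixed points of Frobenius only; elsewhere \<open>prime_field_rep\<close> is
  unspecified.\<close>

definition prime_field_character :: "'a::finite_field \<Rightarrow> complex" where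
  "prime_field_character x = cis (2 * pi / CHAR('a)) ^ prime_field_rep x"

lemma prime_field_character_of_nat:
  "prime_field_character (of_nat k :: 'a::finite_field) = cis (2 * pi / CHAR('a)) ^ k"
proof -
  let ?z = "cis (2 * pi / CHAR('a))"
  have "?z ^ CHAR('a) = 1"
    unfolding Complex.DeMoivre using prime_CHAR[where 'a = 'a] prime_gt_0_nat by auto
  then have "?z ^ (CHAR('a) * (k div CHAR('a)) + k mod CHAR('a)) = ?z ^ (k mod CHAR('a))"
    by (simp only: power_add power_mult) simp
  then show ?thesis
    by (simp add: prime_field_character_def prime_field_rep_of_nat)
qed

lemma prime_field_character_add:
  fixes x y :: "'a::finite_field"
  assumes "x ^ CHAR('a) = x" "y ^ CHAR('a) = y"
  shows "prime_field_character (x + y) = prime_field_character x * prime_field_character y"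
proof -
  obtain k l where "x = of_nat k" "y = of_nat l"
    using assms power_CHAR_eq_self_imp_of_nat by blast
  then show ?thesis
    by (simp add: prime_field_character_of_nat power_add flip: of_nat_add)
qed

lemma prime_field_character_eq_1_imp:
  fixes x :: "'a::finite_field"
  assumes "x ^ CHAR('a) = x" "prime_field_character x = 1"
  shows "x = 0"
proof -
  obtain k where k: "k < CHAR('a)" "x = of_nat k"
    using assms power_CHAR_eq_self_imp_of_nat by blast
  let ?t = "real k * (2 * pi / CHAR('a))"
  have "cis ?t = 1"
    using assms(2) unfolding k prime_field_character_of_nat Complex.DeMoivre .
  \<comment> \<open>Passing to real parts turns the claim into a statement about the angle, which
    must be a multiple of \<open>2 * pi\<close>.\<close>
  then have "cos ?t = 1"
    by (metis cis.simps(1) one_complex.simps(1))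
  then obtain j :: int where "?t = of_int j * 2 * pi"
    using cos_one_2pi_int by blast
  then have "real_of_int (int k) = real_of_int (j * int CHAR('a))"
    using CHAR_pos[where 'a = 'a] by (simp add: field_simps)
  then have "int k = j * int CHAR('a)"
    by (simp only: of_int_eq_iff)
  then have "int CHAR('a) dvd int k" by simp
  then have "k = 0"
    using k(1) by (metis int_dvd_int_iff nat_dvd_not_less neq0_conv)
  then show ?thesis using k by simp
qed

text \<open>
  Double counting: summing \<open>\<chi> (tr (\<mu> x) - f x)\<close> over all \<open>\<mu>\<close> and \<open>x\<close> gives \<open>q\<close>, so for some \<open>\<mu>\<close>
  the inner sum over \<open>x\<close> does not vanish, which forces that character to be trivial.
\<close>

lemma additive_eq_field_tr_mult:
  fixes f :: "'a::finite_field \<Rightarrow> 'a"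
  assumes card: "CARD('a) = CHAR('a) ^ m"
    and add: "\<And>x y. f (x + y) = f x + f y"
    and prime_field: "\<And>x. f x ^ CHAR('a) = f x"
  shows "\<exists>\<mu>. \<forall>x. f x = field_tr CHAR('a) m (\<mu> * x)"
proof (rule ccontr)
  assume neg: "\<not> ?thesis"
  let ?tr = "field_tr CHAR('a) m"
  let ?\<chi> = "prime_field_character :: 'a \<Rightarrow> complex"
  have f0: "f 0 = 0" using add[of 0 0] by (metis add_0 add_cancel_left_left)
  have fm: "f (- x) = - f x" for x
    using add[of x "- x"] f0 by (simp add: add_eq_0_iff2)
  \<comment> \<open>This is \<open>?tr (\<mu> * x) - f x\<close>, written as a sum of two prime
    field values so that additivity of \<open>?\<chi>\<close> applies.\<close>
  define g where "g \<mu> x = ?tr (\<mu> * x) + f (- x)" for \<mu> x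
  have g: "g \<mu> x ^ CHAR('a) = g \<mu> x" for \<mu> x
    unfolding g_def freshmans_dream[OF prime_CHAR refl]
    using field_tr_power_CHAR[OF card] prime_field by simp
  have row: "(\<Sum>x\<in>UNIV. ?\<chi> (g \<mu> x)) = 0" for \<mu>
  proof -
    obtain x where "f x \<noteq> ?tr (\<mu> * x)" using neg by blast
    then have "g \<mu> x \<noteq> 0" by (simp add: g_def fm)
    then have "?\<chi> (g \<mu> x) \<noteq> 1"
      using prime_field_character_eq_1_imp g by blast
    moreover have "g \<mu> (x + y) = g \<mu> x + g \<mu> y" for x y
      using add[of "- x" "- y"] by (simp add: g_def distrib_left field_tr_add)
    ultimately show ?thesis
      by (intro sum_nontrivial_character[of _ x]) (simp_all add: prime_field_character_add g)
  qed
  have col: "(\<Sum>\<mu>\<in>UNIV. ?\<chi> (g \<mu> x)) = (if x = 0 then of_nat CARD('a) else 0)" for x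
  proof (cases "x = 0")
    case True
    then show ?thesis
      using prime_field_character_of_nat[of 0, where 'a = 'a] by (simp add: g_def f0)
  next
    case False
    obtain y :: 'a where y: "?tr y \<noteq> 0" using field_tr_nonzero[OF card] by blast
    \<comment> \<open>For fixed nonzero \<open>x\<close> this is a sum over a character in
      \<open>\<mu>\<close>; the witness \<open>y / x\<close> is taken so that its product with
      \<open>x\<close> has nonzero trace.\<close>
    have "(\<Sum>\<mu>\<in>UNIV. ?\<chi> (?tr (\<mu> * x))) = 0"
    proof (rule sum_nontrivial_character[of _ "y / x"])
      show "?\<chi> (?tr ((\<mu> + \<nu>) * x)) = ?\<chi> (?tr (\<mu> * x)) * ?\<chi> (?tr (\<nu> * x))" for \<mu> \<nu>
        by (simp add: distrib_right field_tr_add prime_field_character_add field_tr_power_CHAR[OF card])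
      show "?\<chi> (?tr (y / x * x)) \<noteq> 1"
        using prime_field_character_eq_1_imp[OF field_tr_power_CHAR[OF card]] y False by auto
    qed
    moreover have "?\<chi> (g \<mu> x) = ?\<chi> (?tr (\<mu> * x)) * ?\<chi> (f (- x))" for \<mu>
      unfolding g_def by (simp add: prime_field_character_add field_tr_power_CHAR[OF card] prime_field)
    ultimately show ?thesis using False by (simp flip: sum_distrib_right)
  qed
  have "of_nat CARD('a) = (\<Sum>x\<in>UNIV. \<Sum>\<mu>\<in>UNIV. ?\<chi> (g \<mu> x))"
    by (simp add: col)
  also have "\<dots> = (\<Sum>\<mu>\<in>UNIV. \<Sum>x\<in>UNIV. ?\<chi> (g \<mu> x))"
    by (rule sum.swap)
  also have "\<dots> = 0" by (simp add: row)
  finally show False by simp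
qed

section \<open>Automorphisms of finite fields\<close>

interpretation Aut: group "field_Aut :: ('a::field \<Rightarrow> 'a) monoid"
  by (rule group_field_Aut)

lemma field_AutD:
  assumes "\<sigma> \<in> carrier field_Aut"
  shows "bij \<sigma>" "\<sigma> 1 = 1" "\<sigma> (x + y) = \<sigma> x + \<sigma> y" "\<sigma> (x * y) = \<sigma> x * \<sigma> y"
  using assms by (auto simp: field_Aut_def)

lemma field_Aut_0:
  assumes "\<sigma> \<in> carrier field_Aut"
  shows "\<sigma> 0 = 0"
  using field_AutD(3)[OF assms, of 0 0] by (metis add_0 add_cancel_left_left)

lemma field_Aut_uminus:
  assumes "\<sigma> \<in> carrier field_Aut"
  shows "\<sigma> (- x) = - \<sigma> x"
  using field_AutD(3)[OF assms, of x "- x"] field_Aut_0[OF assms] by (simp add: add_eq_0_iff2)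

lemma field_Aut_diff:
  assumes "\<sigma> \<in> carrier field_Aut"
  shows "\<sigma> (x - y) = \<sigma> x - \<sigma> y"
  using field_AutD(3)[OF assms, of x "- y"] field_Aut_uminus[OF assms] by simp

lemma field_Aut_of_nat:
  assumes "\<sigma> \<in> carrier field_Aut"
  shows "\<sigma> (of_nat n) = of_nat n"
  by (induction n) (simp_all add: field_Aut_0[OF assms] field_AutD[OF assms])

lemma field_Aut_power:
  assumes "\<sigma> \<in> carrier field_Aut"
  shows "\<sigma> (x ^ n) = \<sigma> x ^ n"
  by (induction n) (simp_all add: field_AutD[OF assms])

lemma field_Aut_sum:
  assumes "\<sigma> \<in> carrier field_Aut"
  shows "\<sigma> (sum f A) = (\<Sum>x\<in>A. \<sigma> (f x))"
  by (induction A rule: infinite_finite_induct)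
    (simp_all add: field_Aut_0[OF assms] field_AutD[OF assms])

lemma field_Aut_field_tr:
  assumes "\<sigma> \<in> carrier field_Aut"
  shows "\<sigma> (field_tr p m x) = field_tr p m (\<sigma> x)"
  by (simp add: field_tr_def field_Aut_sum[OF assms] field_Aut_power[OF assms])

lemma field_Aut_mult: "\<sigma> \<otimes>\<^bsub>field_Aut\<^esub> \<tau> = \<tau> \<circ> \<sigma>"
  by (simp add: field_Aut_def)

lemma field_Aut_one: "\<one>\<^bsub>field_Aut\<^esub> = id"
  by (simp add: field_Aut_def)

lemma field_Aut_poly:
  assumes "\<sigma> \<in> carrier field_Aut"
  shows "\<sigma> (poly P x) = poly (map_poly \<sigma> P) (\<sigma> x)"
  by (induction P)
    (simp_all add: field_Aut_0[OF assms] field_AutD[OF assms] map_poly_pCons)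

section \<open>Frobenius as a generator of the automorphism group\<close>

lemma frobenius_in_field_Aut: "(\<lambda>x::'a::finite_field. x ^ CHAR('a)) \<in> carrier field_Aut"
proof -
  have add: "(x + y) ^ CHAR('a) = x ^ CHAR('a) + y ^ CHAR('a)" for x y :: 'a
    by (rule freshmans_dream[OF prime_CHAR refl])
  have "inj (\<lambda>x::'a. x ^ CHAR('a))"
  proof (rule injI)
    fix x y :: 'a
    assume "x ^ CHAR('a) = y ^ CHAR('a)"
    then have "(x - y) ^ CHAR('a) = 0"
      using add[of "x - y" y] by simp
    then show "x = y" by simp
  qed
  then have "bij (\<lambda>x::'a. x ^ CHAR('a))"
    by (simp add: bij_def finite_UNIV_inj_surj)
  then show ?thesis
    by (simp add: field_Aut_def add power_mult_distrib)
qed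

lemma frobenius_pow:
  "(\<lambda>x::'a::finite_field. x ^ CHAR('a)) [^]\<^bsub>field_Aut\<^esub> (i::nat) = (\<lambda>x. x ^ (CHAR('a) ^ i))"
  by (induction i)
    (auto simp: field_Aut_one field_Aut_mult fun_eq_iff mult.commute simp flip: power_mult)

text \<open>The multiplicative group is cyclic. That theorem speaks of algebraic records, so the
  type-class field is repackaged as the record \<open>R\<close>.\<close>

lemma finite_field_has_generator:
  "\<exists>w::'a::finite_field. \<forall>x. x \<noteq> 0 \<longrightarrow> (\<exists>i. x = w ^ i)"
proof -
  define R :: "'a ring" where
    "R = \<lparr>carrier = UNIV, monoid.mult = (*), one = 1, zero = 0, add = (+)\<rparr>"
  interpret R: field R
  proof (rule cring.cring_fieldI2)
    show "cring R"
    proof (rule cringI)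
      show "abelian_group R"
      proof (rule abelian_groupI)
        show "\<exists>y\<in>carrier R. y \<oplus>\<^bsub>R\<^esub> x = \<zero>\<^bsub>R\<^esub>" for x
          by (intro bexI[of _ "- x"]) (auto simp: R_def)
      qed (auto simp: R_def algebra_simps)
      show "comm_monoid R"
        by (rule comm_monoidI) (auto simp: R_def algebra_simps)
    qed (auto simp: R_def algebra_simps)
    show "\<exists>b\<in>carrier R. a \<otimes>\<^bsub>R\<^esub> b = \<one>\<^bsub>R\<^esub>" if "a \<noteq> \<zero>\<^bsub>R\<^esub>" for a
      using that by (intro bexI[of _ "inverse a"]) (auto simp: R_def)
  qed (auto simp: R_def)
  have pow: "x [^]\<^bsub>R\<^esub> (i::nat) = x ^ i" for x i
    by (induction i) (auto simp: R_def mult.commute)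
  have "carrier (mult_of R) = {x. x \<noteq> 0}"
    by (auto simp: R_def)
  moreover obtain w where "carrier (mult_of R) = {w [^]\<^bsub>R\<^esub> i | i::nat. i \<in> UNIV}"
    using R.finite_field_mult_group_has_gen by (auto simp: R_def)
  ultimately have "{x. x \<noteq> 0} = {w ^ i | i::nat. i \<in> UNIV}"
    by (simp add: pow)
  then show ?thesis by blast
qed

text \<open>
  The conjugates \<open>w ^ (p ^ i)\<close> of a generator \<open>w\<close> are the roots of a polynomial over the prime
  field, and every automorphism permutes these roots.
\<close>

lemma field_Aut_eq_frobenius_pow:
  fixes \<sigma> :: "'a::finite_field \<Rightarrow> 'a"
  assumes card: "CARD('a) = CHAR('a) ^ m" and \<sigma>: "\<sigma> \<in> carrier field_Aut"
  shows "\<exists>i::nat. \<sigma> = (\<lambda>x. x ^ CHAR('a)) [^]\<^bsub>field_Aut\<^esub> i"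
proof -
  let ?p = "CHAR('a)" and ?F = "\<lambda>x::'a. x ^ CHAR('a)"
  note F = frobenius_in_field_Aut[where 'a = 'a]
  obtain w :: 'a where w: "\<And>x. x \<noteq> 0 \<Longrightarrow> \<exists>i. x = w ^ i"
    using finite_field_has_generator by blast
  define P where "P = (\<Prod>i<m. [:- (w ^ (?p ^ i)), 1:])"
  have ev: "poly P z = (\<Prod>i<m. z - w ^ (?p ^ i))" for z
    by (simp add: P_def poly_prod)
  have "degree P \<le> (\<Sum>i<m. degree [:- (w ^ (?p ^ i)), 1:])"
    unfolding P_def by (rule order_trans[OF degree_prod_sum_le]) simp_all
  then have deg: "degree P \<le> m" by simp
  have p1: "?p > 1"
    using prime_CHAR prime_gt_1_nat by blast
  then have "2 ^ m \<le> ?p ^ m"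
    by (intro power_mono) auto
  \<comment> \<open>This bound makes a polynomial of degree at most \<open>m\<close> that vanishes
    everywhere the zero polynomial.\<close>
  then have mq: "m < CARD('a)"
    using card less_exp[of m] by linarith
  \<comment> \<open>Frobenius permutes the roots of \<open>P\<close> cyclically, because
    \<open>w ^ (?p ^ m) = w\<close>, so both polynomials take the same values.\<close>
  have eq: "map_poly ?F P = P"
  proof (rule ccontr)
    assume "map_poly ?F P \<noteq> P"
    then have nz: "map_poly ?F P - P \<noteq> 0" by simp
    have "poly (map_poly ?F P - P) y = 0" for y
    proof -
      obtain z where z: "y = ?F z"
        using field_AutD(1)[OF F] by (metis bij_pointE)
      have "poly (map_poly ?F P) y = ?F (poly P z)"
        unfolding z by (rule field_Aut_poly[OF F, symmetric])
      also have "\<dots> = (\<Prod>i<m. ?F (z - w ^ (?p ^ i)))"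
        by (simp add: ev prod_power_distrib)
      also have "\<dots> = (\<Prod>i<m. y - w ^ (?p ^ Suc i))"
        unfolding field_Aut_diff[OF F] z by (simp add: mult.commute flip: power_mult)
      also have "\<dots> = poly P y"
      proof (cases m)
        case 0
        then show ?thesis by (simp add: ev)
      next
        case (Suc n)
        have "(\<Prod>i<m. y - w ^ (?p ^ Suc i)) = (\<Prod>i<n. y - w ^ (?p ^ Suc i)) * (y - w ^ (?p ^ m))"
          by (simp add: Suc)
        also have "w ^ (?p ^ m) = w ^ (?p ^ 0)"
          using finite_field_power_card_eq_same[of w] card by simp
        finally show ?thesis
          unfolding ev Suc prod.lessThan_Suc_shift by (simp add: mult.commute)
      qed
      finally show ?thesis by simp
    qed
    then have "{y. poly (map_poly ?F P - P) y = 0} = UNIV" by blast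
    moreover have "degree (map_poly ?F P - P) \<le> m"
      using deg order_trans[OF map_poly_degree_leq deg] by (intro degree_diff_le) auto
    ultimately show False
      using card_poly_roots_bound[OF nz] mq by simp
  qed
  \<comment> \<open>By \<open>eq\<close> the coefficients lie in the prime field, which every
    automorphism fixes.\<close>
  have "map_poly \<sigma> P = P"
  proof (rule poly_eqI)
    fix n
    have "coeff P n ^ ?p = coeff P n"
      using arg_cong[OF eq, of "\<lambda>Q. coeff Q n"] by (simp add: coeff_map_poly)
    then obtain k where "coeff P n = of_nat k"
      using power_CHAR_eq_self_imp_of_nat by blast
    then show "coeff (map_poly \<sigma> P) n = coeff P n"
      by (simp add: coeff_map_poly field_Aut_0[OF \<sigma>] field_Aut_of_nat[OF \<sigma>])
  qed
  \<comment> \<open>This secures the factor of \<open>P\<close> at index 0, whose root is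
    \<open>w\<close>.\<close>
  moreover have "m \<noteq> 0"
    using mq p1 card card_mono[of UNIV "{0, 1 :: 'a}"] by (intro notI) simp
  then have "poly P w = 0"
    by (auto simp: ev intro!: prod_zero bexI[of _ 0])
  ultimately have "poly P (\<sigma> w) = 0"
    using field_Aut_poly[OF \<sigma>, of P w] field_Aut_0[OF \<sigma>] by simp
  then obtain i where i: "\<sigma> w = w ^ (?p ^ i)"
    by (auto simp: ev)
  have "\<sigma> x = x ^ (?p ^ i)" for x
  proof (cases "x = 0")
    case True
    then show ?thesis using p1 by (simp add: field_Aut_0[OF \<sigma>])
  next
    case False
    then obtain n where "x = w ^ n" using w by blast
    then show ?thesis
      by (simp add: field_Aut_power[OF \<sigma>] i mult.commute flip: power_mult)
  qed
  then show ?thesis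
    unfolding frobenius_pow by (auto simp: fun_eq_iff)
qed

text \<open>The powers of \<open>z\<close> killed by \<open>p\<close> form a group of order
  \<open>p\<close>, which any of its elements of order \<open>p\<close> generates.\<close>

lemma (in group) pow_prime_eq_one_imp_pow_of_ord_prime:
  fixes i j p :: nat
  assumes z: "z \<in> carrier G" and p: "prime p"
    and x: "(z [^] i) [^] p = \<one>" and y: "ord (z [^] j) = p"
  shows "\<exists>k::nat. z [^] i = (z [^] j) [^] k"
proof -
  define d where "d = ord z"
  have d: "z [^] (n::nat) = \<one> \<longleftrightarrow> d dvd n" for n
    unfolding d_def by (rule pow_eq_id[OF z])
  have di: "d dvd i * p"
    using x by (simp add: nat_pow_pow[OF z] d)
  have dj: "d dvd j * p"
    using pow_ord_eq_1[of "z [^] j"] z by (simp add: y nat_pow_pow[OF z] d)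
  have ndj: "\<not> d dvd j"
  proof
    assume "d dvd j"
    then have "z [^] j = \<one>" by (simp add: d)
    then show False using y p by auto
  qed
  have "p dvd d"
  proof (rule ccontr)
    assume "\<not> p dvd d"
    then have "coprime d p"
      using p prime_imp_coprime coprime_commute by blast
    then show False
      using dj ndj by (simp add: coprime_dvd_mult_left_iff)
  qed
  then obtain d' where d': "d = p * d'" by blast
  have p0: "p > 0" using p prime_gt_0_nat by blast
  obtain i' where i': "i = d' * i'"
    using di p0 unfolding d' by (metis dvdE dvd_mult_cancel mult.commute)
  obtain j' where j': "j = d' * j'"
    using dj p0 unfolding d' by (metis dvdE dvd_mult_cancel mult.commute)
  have "\<not> p dvd j'"
    using ndj unfolding d' j' by (auto simp: mult.commute)
  then have "coprime j' p"
    using p prime_imp_coprime coprime_commute by blast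
  \<comment> \<open>Since \<open>u\<close> inverts \<open>j'\<close> modulo \<open>p\<close>, the
    exponent \<open>j * (u * i')\<close> is congruent to \<open>i\<close> modulo
    \<open>d = p * d'\<close>.\<close>
  then obtain u where u: "[j' * u = 1] (mod p)"
    using cong_solve_coprime_nat by auto
  have "[j' * u * i' = 1 * i'] (mod p)"
    using u by (rule cong_mult) simp
  then have "int p dvd int (j' * u * i') - int i'"
    by (simp add: cong_iff_dvd_diff flip: cong_int_iff)
  then have "int d dvd int d' * (int (j' * u * i') - int i')"
    unfolding d' by simp
  then have "int d dvd int (j * (u * i')) - int i"
    by (simp add: i' j' algebra_simps)
  then have "z [^] i = z [^] (j * (u * i'))"
    using int_pow_eq[OF z, of "int i" "int (j * (u * i'))"] unfolding d_def int_pow_int by blast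
  then show ?thesis
    by (auto simp: nat_pow_pow[OF z])
qed

lemma field_Aut_pow_of_ord_CHAR:
  fixes \<sigma> g :: "'a::finite_field \<Rightarrow> 'a"
  assumes card: "CARD('a) = CHAR('a) ^ m"
    and \<sigma>: "\<sigma> \<in> carrier field_Aut" "\<sigma> [^]\<^bsub>field_Aut\<^esub> CHAR('a) = \<one>\<^bsub>field_Aut\<^esub>"
    and g: "g \<in> carrier field_Aut" "Aut.ord g = CHAR('a)"
  shows "\<exists>k::nat. \<sigma> = g [^]\<^bsub>field_Aut\<^esub> k"
proof -
  let ?F = "\<lambda>x::'a. x ^ CHAR('a)"
  obtain i j :: nat where "\<sigma> = ?F [^]\<^bsub>field_Aut\<^esub> i" "g = ?F [^]\<^bsub>field_Aut\<^esub> j"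
    using field_Aut_eq_frobenius_pow[OF card] \<sigma>(1) g(1) by blast
  then show ?thesis
    using Aut.pow_prime_eq_one_imp_pow_of_ord_prime[OF frobenius_in_field_Aut prime_CHAR] \<sigma>(2) g(2)
    by blast
qed

section \<open>Homomorphisms for a twisted addition\<close>

locale twisted_hom =
  fixes t :: "'a::finite_field \<Rightarrow> 'a \<Rightarrow> 'a"
  assumes t_Aut: "t x \<in> carrier field_Aut"
    and t_twisted: "t (t y x + y) = t x \<otimes>\<^bsub>field_Aut\<^esub> t y"
begin

text \<open>The product of \<open>G_A\<close> or \<open>G_B\<close>, read on the parameter, takes
  this form.\<close>

definition twisted_group :: "'a monoid" where
  "twisted_group = \<lparr>carrier = UNIV, monoid.mult = (\<lambda>x y. t y x + y), one = 0\<rparr>"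

lemma group_twisted_group: "group twisted_group"
proof (rule groupI)
  fix x
  obtain y where "t x y = - x"
    using field_AutD(1)[OF t_Aut] by (metis bij_pointE)
  then show "\<exists>y\<in>carrier twisted_group. y \<otimes>\<^bsub>twisted_group\<^esub> x = \<one>\<^bsub>twisted_group\<^esub>"
    by (intro bexI[of _ y]) (auto simp: twisted_group_def)
qed (auto simp: twisted_group_def t_twisted field_Aut_mult field_AutD(3)[OF t_Aut]
    field_Aut_0[OF t_Aut])

lemma group_hom_t: "group_hom twisted_group field_Aut t"
  by (intro group_hom.intro group_hom_axioms.intro group_twisted_group group_field_Aut homI)
    (auto simp: twisted_group_def t_Aut t_twisted)

lemma t_twisted_pow: "t (x [^]\<^bsub>twisted_group\<^esub> (n::nat)) = t x [^]\<^bsub>field_Aut\<^esub> n"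
  using group_hom.hom_nat_pow[OF group_hom_t] by (simp add: twisted_group_def)

lemma t_0: "t 0 = id"
  using group_hom.hom_one[OF group_hom_t] by (simp add: twisted_group_def field_Aut_one)

text \<open>Lagrange's theorem in the twisted group, whose order is the field size.\<close>

lemma t_pow_CARD: "t x [^]\<^bsub>field_Aut\<^esub> CARD('a) = \<one>\<^bsub>field_Aut\<^esub>"
proof -
  have "x [^]\<^bsub>twisted_group\<^esub> CARD('a) = 0"
    using group.pow_order_eq_1[OF group_twisted_group, of x]
    by (simp add: twisted_group_def Coset.order_def)
  then show ?thesis
    using t_twisted_pow[of x "CARD('a)"] by (simp add: t_0 field_Aut_one)
qed

section \<open>The kernel of \<open>t\<close> and its additive cosets\<close>

lemma t_add_kernel: "t k = id \<Longrightarrow> t (x + k) = t x"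
  using t_twisted[of k x] by (simp add: field_Aut_mult)

lemma t_uminus_kernel: "t k = id \<Longrightarrow> t (- k) = id"
  using t_add_kernel[of k "- k"] by (simp add: t_0)

text \<open>If \<open>z\<close> is a twisted inverse of \<open>x\<close> and
  \<open>t x = t y\<close>, the twisted products of \<open>z\<close> with \<open>x\<close> and with
  \<open>y\<close> both lie in the kernel, and the term in \<open>z\<close> cancels from their
  difference.\<close>

lemma t_eq_iff: "t x = t y \<longleftrightarrow> t (x - y) = id"
proof
  assume eq: "t x = t y"
  obtain z where "t x z + x = 0"
    using group.l_inv_ex[OF group_twisted_group, of x] by (auto simp: twisted_group_def)
  then have z: "t z \<otimes>\<^bsub>field_Aut\<^esub> t x = id"
    using t_twisted[of x z] by (simp add: t_0)
  have "t (t x z + x) = id" "t (t x z + y) = id"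
    using t_twisted[of x z] t_twisted[of y z] z eq by auto
  then have "t ((t x z + x) + - (t x z + y)) = id"
    using t_add_kernel t_uminus_kernel by metis
  then show "t (x - y) = id" by simp
next
  assume "t (x - y) = id"
  then show "t x = t y"
    using t_add_kernel[of "x - y" y] by simp
qed

text \<open>The twisted product of \<open>k\<close> with \<open>y\<close> has the value
  \<open>t y\<close>, so by \<open>t_eq_iff\<close> what it adds to \<open>y\<close> lies in the
  kernel.\<close>

lemma t_kernel_invariant:
  assumes "t k = id"
  shows "t (t y k) = id"
proof -
  have "t (t y k + y) = t y"
    using t_twisted[of y k] assms by (simp add: field_Aut_mult)
  then show ?thesis
    using t_eq_iff[of "t y k + y" y] by simp
qed

lemma t_prime_field_mult_kernel:
  assumes "c ^ CHAR('a) = c" "t k = id"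
  shows "t (c * k) = id"
proof -
  have "t (of_nat n * k) = id" for n
    using assms(2) by (induction n) (simp_all add: t_0 t_add_kernel distrib_right)
  then show ?thesis
    using power_CHAR_eq_self_imp_of_nat[OF assms(1)] by blast
qed

text \<open>
  If the image of \<open>t\<close> is \<open>\<langle>g\<rangle>\<close>, the kernel \<open>K\<close> is a hyperplane over the prime field which is
  stable under \<open>g\<close>. On the quotient line \<open>g\<close> acts as a scalar \<open>c\<close> with \<open>c = c ^ p = 1\<close>, so
  that \<open>t y\<close> may be dropped from \<open>t (t y x + y)\<close>.
\<close>

lemma t_apply_generator:
  assumes g: "g \<in> carrier field_Aut" "Aut.ord g = CHAR('a)"
    and img: "\<And>x. \<exists>k::nat. t x = g [^]\<^bsub>field_Aut\<^esub> k"
  shows "t (g x) = t x"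
proof (cases "\<forall>x. t x = id")
  case True
  then show ?thesis by simp
next
  case False
  let ?p = "CHAR('a)"
  have p: "prime ?p" by (rule prime_CHAR)
  obtain v where v: "t v \<noteq> id" using False by blast
  obtain k :: nat where k: "t v = g [^]\<^bsub>field_Aut\<^esub> k" using img by blast
  have "\<not> ?p dvd k"
    using Aut.pow_eq_id[OF g(1), of k] v k g(2) by (auto simp: field_Aut_one)
  then have "coprime k ?p"
    using p prime_imp_coprime coprime_commute by blast
  then obtain j where j: "[k * j = 1] (mod ?p)"
    using cong_solve_coprime_nat by auto
  \<comment> \<open>As \<open>j\<close> inverts \<open>k\<close> modulo \<open>?p\<close>, this is a
    preimage of \<open>g\<close> itself.\<close>
  define u where "u = v [^]\<^bsub>twisted_group\<^esub> j"
  have "t u = g [^]\<^bsub>field_Aut\<^esub> (k * j)"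
    unfolding u_def t_twisted_pow k by (rule Aut.nat_pow_pow[OF g(1)])
  also have "\<dots> = g [^]\<^bsub>field_Aut\<^esub> (1::nat)"
  proof -
    have "int ?p dvd int 1 - int (k * j)"
      using cong_sym[OF j] by (metis cong_iff_dvd_diff cong_int_iff)
    then show ?thesis
      using Aut.int_pow_eq[OF g(1), of "int (k * j)" "int 1"] unfolding int_pow_int g(2) by blast
  qed
  finally have u: "t u = g" using g(1) by simp
  have "g \<noteq> id"
    using p g(2) Aut.ord_id by (metis field_Aut_one not_prime_1)
  then have u_notin: "t u \<noteq> id" using u by simp
  \<comment> \<open>The prime field line through \<open>u\<close> meets the kernel only in 0:
    dividing by a nonzero \<open>c\<close> would put \<open>u\<close> into the kernel.\<close>
  have u_mult: "c = 0" if c: "c ^ ?p = c" "t (c * u) = id" for c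
  proof (rule ccontr)
    assume "c \<noteq> 0"
    moreover have "inverse c ^ ?p = inverse c"
      using c(1) by (simp add: power_inverse)
    then have "t (inverse c * (c * u)) = id"
      using c(2) by (rule t_prime_field_mult_kernel)
    ultimately show False using u_notin by (simp flip: mult.assoc)
  qed
  \<comment> \<open>The multiples \<open>of_nat i * u\<close> with \<open>i < ?p\<close> have
    distinct values among at most \<open>?p\<close> powers of \<open>g\<close>, so they take every
    value of \<open>t\<close>.\<close>
  have coset: "\<exists>i. t (x - of_nat i * u) = id" for x
  proof -
    let ?f = "\<lambda>i. t (of_nat i * u)"
    let ?S = "(\<lambda>k. g [^]\<^bsub>field_Aut\<^esub> k) ` {..<?p}"
    have S: "t y \<in> ?S" for y
    proof -
      obtain k :: nat where "t y = g [^]\<^bsub>field_Aut\<^esub> k" using img by blast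
      also have "\<dots> = g [^]\<^bsub>field_Aut\<^esub> (?p * (k div ?p) + k mod ?p)" by simp
      also have "\<dots> = g [^]\<^bsub>field_Aut\<^esub> (?p * (k div ?p)) \<otimes>\<^bsub>field_Aut\<^esub> g [^]\<^bsub>field_Aut\<^esub> (k mod ?p)"
        by (rule Aut.nat_pow_mult[OF g(1), symmetric])
      also have "g [^]\<^bsub>field_Aut\<^esub> (?p * (k div ?p)) = \<one>\<^bsub>field_Aut\<^esub>"
        by (simp add: Aut.pow_eq_id[OF g(1)] g(2))
      finally have "t y = g [^]\<^bsub>field_Aut\<^esub> (k mod ?p)"
        using g(1) by simp
      then show ?thesis by auto
    qed
    have "inj_on ?f {..<?p}"
    proof (rule inj_onI)
      fix i j
      assume ij: "i \<in> {..<?p}" "j \<in> {..<?p}" "?f i = ?f j"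
      have "(of_nat i - of_nat j :: 'a) ^ ?p = of_nat i - of_nat j"
        using field_Aut_diff[OF frobenius_in_field_Aut, of "of_nat i :: 'a" "of_nat j"]
        by (simp add: of_nat_power_CHAR)
      moreover have "t ((of_nat i - of_nat j) * u) = id"
        using ij(3) by (simp add: t_eq_iff left_diff_distrib)
      ultimately have "of_nat i - of_nat j = (0 :: 'a)"
        by (rule u_mult)
      then show "i = j"
        using ij(1,2) by (simp add: of_nat_eq_iff_cong_CHAR cong_less_modulus_unique_nat)
    qed
    then have "card (?f ` {..<?p}) = ?p"
      by (simp add: card_image)
    moreover have "card ?S \<le> ?p"
      using card_image_le[of "{..<?p}"] by simp
    ultimately have "?f ` {..<?p} = ?S"
      using S by (intro card_seteq) auto
    then have "t x \<in> ?f ` {..<?p}" using S by blast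
    then show ?thesis by (auto simp: t_eq_iff)
  qed
  have g_kernel: "t (g y) = id" if "t y = id" for y
    using t_kernel_invariant[OF that, of u] u by simp
  obtain i where i: "t (g u - of_nat i * u) = id" using coset by blast
  define c :: 'a where "c = of_nat i"
  have cp: "c ^ ?p = c" by (simp add: c_def of_nat_power_CHAR)
  have gc: "g (c ^ n) = c ^ n" for n
    using field_Aut_of_nat[OF g(1), of "i ^ n"] by (simp add: c_def)
  \<comment> \<open>Modulo the kernel \<open>g\<close> multiplies \<open>u\<close> by
    \<open>c\<close>, and \<open>g\<close> fixes \<open>c\<close> and preserves the kernel, so
    iteration gives \<open>c ^ n\<close>.\<close>
  have pow: "t ((g [^]\<^bsub>field_Aut\<^esub> n) u - c ^ n * u) = id" for n :: nat
  proof (induction n)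
    case 0
    then show ?case by (simp add: field_Aut_one t_0)
  next
    case (Suc n)
    have "(c ^ n) ^ ?p = c ^ n"
      using cp by (metis mult.commute power_mult)
    then have "t (c ^ n * (g u - c * u)) = id"
      using i by (simp add: c_def t_prime_field_mult_kernel)
    with g_kernel[OF Suc]
    have "t (g ((g [^]\<^bsub>field_Aut\<^esub> n) u - c ^ n * u) + c ^ n * (g u - c * u)) = id"
      by (simp add: t_add_kernel)
    then show ?case
      by (simp add: field_Aut_mult field_Aut_diff[OF g(1)] field_AutD(4)[OF g(1)] gc
          algebra_simps)
  qed
  \<comment> \<open>At \<open>n = ?p\<close> the iterate is the identity and
    \<open>c ^ ?p = c\<close>, so \<open>(1 - c) * u\<close> is in the kernel and
    \<open>u_mult\<close> gives \<open>c = 1\<close>.\<close>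
  have "g [^]\<^bsub>field_Aut\<^esub> ?p = \<one>\<^bsub>field_Aut\<^esub>"
    using Aut.pow_ord_eq_1[OF g(1)] g(2) by simp
  then have "t ((1 - c) * u) = id"
    using pow[of ?p] cp by (simp add: field_Aut_one left_diff_distrib)
  moreover have "(1 - c) ^ ?p = 1 - c"
    using field_Aut_diff[OF frobenius_in_field_Aut, of 1 c] cp by simp
  ultimately have "c = 1" using u_mult[of "1 - c"] by simp
  then have gu: "t (g u - u) = id" using i by (simp add: c_def)
  obtain n where n: "t (x - of_nat n * u) = id" using coset by blast
  \<comment> \<open>Splitting \<open>x\<close> as \<open>?k + of_nat n * u\<close> exhibits
    \<open>g x - x\<close> as a sum of kernel elements.\<close>
  let ?k = "x - of_nat n * u"
  have "t (g ?k + of_nat n * (g u - u) + - ?k) = id"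
    using g_kernel[OF n] t_uminus_kernel[OF n]
      t_prime_field_mult_kernel[OF of_nat_power_CHAR gu] by (simp only: t_add_kernel)
  moreover have "g ?k + of_nat n * (g u - u) + - ?k = g x - x"
    by (simp add: field_Aut_diff[OF g(1)] field_AutD(4)[OF g(1)] field_Aut_of_nat[OF g(1)]
        algebra_simps)
  ultimately show ?thesis by (metis t_eq_iff)
qed

lemma t_add:
  assumes g: "g \<in> carrier field_Aut" "Aut.ord g = CHAR('a)"
    and img: "\<And>x. \<exists>k::nat. t x = g [^]\<^bsub>field_Aut\<^esub> k"
  shows "t (x + y) = t x \<otimes>\<^bsub>field_Aut\<^esub> t y"
proof -
  have "t ((g [^]\<^bsub>field_Aut\<^esub> k) x) = t x" for k :: nat
    by (induction k) (simp_all add: field_Aut_one field_Aut_mult t_apply_generator[OF assms])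
  then have "t (t y x) = t x" using img by metis
  then have "t (t y x + y) = t (x + y)"
    by (simp add: t_eq_iff)
  then show ?thesis by (simp add: t_twisted)
qed

theorem t_eq_pow_field_tr:
  assumes card: "CARD('a) = CHAR('a) ^ m"
    and g: "g \<in> carrier field_Aut" "Aut.ord g = CHAR('a)"
    and exp: "\<And>x. t x [^]\<^bsub>field_Aut\<^esub> CHAR('a) = \<one>\<^bsub>field_Aut\<^esub>"
  shows "\<exists>\<mu>. g \<mu> = \<mu> \<and>
    (\<forall>x. t x = g [^]\<^bsub>field_Aut\<^esub> prime_field_rep (field_tr CHAR('a) m (\<mu> * x)))"
proof -
  let ?tr = "field_tr CHAR('a) m"
  have img: "\<exists>k::nat. t x = g [^]\<^bsub>field_Aut\<^esub> k" for x
    by (rule field_Aut_pow_of_ord_CHAR[OF card t_Aut exp g])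
  then obtain f :: "'a \<Rightarrow> nat" where f: "\<And>x. t x = g [^]\<^bsub>field_Aut\<^esub> f x" by metis
  \<comment> \<open>Exponents of \<open>g\<close> count only modulo its order
    \<open>CHAR('a)\<close>, so they can be read in the prime field, whatever choice
    \<open>f\<close> makes.\<close>
  have pow_eq: "g [^]\<^bsub>field_Aut\<^esub> a = g [^]\<^bsub>field_Aut\<^esub> b \<longleftrightarrow> of_nat a = (of_nat b :: 'a)"
    for a b :: nat
  proof -
    have "g [^]\<^bsub>field_Aut\<^esub> a = g [^]\<^bsub>field_Aut\<^esub> b \<longleftrightarrow> int CHAR('a) dvd int b - int a"
      using Aut.int_pow_eq[OF g(1), of "int a" "int b"] unfolding int_pow_int g(2) .
    also have "\<dots> \<longleftrightarrow> [a = b] (mod CHAR('a))"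
      by (metis cong_iff_dvd_diff cong_int_iff cong_sym_eq)
    finally show ?thesis by (simp add: of_nat_eq_iff_cong_CHAR)
  qed
  define F :: "'a \<Rightarrow> 'a" where "F x = of_nat (f x)" for x
  have "F (x + y) = F x + F y" for x y
    using t_add[OF g img, of x y] pow_eq[of "f (x + y)" "f x + f y"]
    by (simp add: F_def f Aut.nat_pow_mult[OF g(1)])
  moreover have "F x ^ CHAR('a) = F x" for x
    by (simp add: F_def of_nat_power_CHAR)
  ultimately obtain \<mu> where \<mu>: "\<And>x. F x = ?tr (\<mu> * x)"
    using additive_eq_field_tr_mult[OF card, of F] by blast
  have "t x = g [^]\<^bsub>field_Aut\<^esub> prime_field_rep (?tr (\<mu> * x))" for x
    using of_nat_prime_field_rep[OF field_tr_power_CHAR[OF card], of "\<mu> * x"] \<mu>[of x]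
    by (simp add: f pow_eq F_def)
  \<comment> \<open>Since \<open>g\<close> commutes with the trace and fixes prime field values,
    \<open>g \<mu>\<close> and \<open>\<mu>\<close> represent the same function \<open>F\<close>,
    and nondegeneracy makes them equal.\<close>
  moreover have "g \<mu> = \<mu>"
  proof -
    have "?tr ((g \<mu> - \<mu>) * z) = 0" for z
    proof -
      obtain x where x: "z = g x"
        using field_AutD(1)[OF g(1)] by (metis bij_pointE)
      have "?tr (g \<mu> * z) = g (?tr (\<mu> * x))"
        by (simp add: x field_Aut_field_tr[OF g(1)] field_AutD(4)[OF g(1)])
      also have "\<dots> = F x"
        by (simp add: F_def field_Aut_of_nat[OF g(1)] flip: \<mu>)
      also have "\<dots> = F z"
        using t_apply_generator[OF g img, of x] by (simp add: F_def f pow_eq x)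
      finally have "?tr (g \<mu> * z) = ?tr (\<mu> * z)" by (simp add: \<mu>)
      moreover have "?tr (g \<mu> * z) = ?tr ((g \<mu> - \<mu>) * z) + ?tr (\<mu> * z)"
        by (simp add: algebra_simps flip: field_tr_add)
      ultimately show ?thesis by simp
    qed
    then show ?thesis
      using field_tr_mult_nondegenerate[OF card, of "g \<mu> - \<mu>"] by simp
  qed
  ultimately show ?thesis by blast
qed

text \<open>
  The exponent of the image divides \<open>q\<close>, so the definite description in \<open>exponent_log\<close> denotes.
\<close>

lemma t_pow_CHAR_if_exponent_log_le_1:
  assumes card: "CARD('a) = CHAR('a) ^ m"
    and img: "psi ` H = range t" and le: "exponent_log CHAR('a) H \<le> 1"
  shows "t x [^]\<^bsub>field_Aut\<^esub> CHAR('a) = \<one>\<^bsub>field_Aut\<^esub>"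
proof -
  let ?p = "CHAR('a)"
  let ?P = "\<lambda>n. n > 0 \<and> (\<forall>h\<in>range t. h [^]\<^bsub>field_Aut\<^esub> n = \<one>\<^bsub>field_Aut\<^esub>)"
  define e where "e = group_exponent field_Aut (range t)"
  have e_Least: "e = (LEAST n. ?P n)" by (simp add: e_def group_exponent_def)
  have q: "?P CARD('a)" using t_pow_CARD by auto
  have e: "?P e" unfolding e_Least by (rule LeastI[of ?P, OF q])
  \<comment> \<open>Otherwise the remainder modulo \<open>e\<close> would be a smaller positive
    exponent.\<close>
  have "e dvd CARD('a)"
  proof (rule ccontr)
    assume "\<not> e dvd CARD('a)"
    then have "CARD('a) mod e > 0" by (simp add: mod_greater_zero_iff_not_dvd)
    moreover have "Aut.ord (t x) dvd CARD('a) mod e" for x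
      using e q by (intro dvd_mod) (auto simp: Aut.pow_eq_id[OF t_Aut])
    ultimately have "?P (CARD('a) mod e)" by (auto simp: Aut.pow_eq_id[OF t_Aut])
    then have "e \<le> CARD('a) mod e" unfolding e_Least by (rule Least_le)
    then show False using e mod_less_divisor[of e "CARD('a)"] by linarith
  qed
  then obtain r where r: "e = ?p ^ r"
    using divides_primepow_nat[OF prime_CHAR] card by auto
  have "?p > 1"
    using prime_CHAR prime_gt_1_nat by blast
  then have "exponent_log ?p H = r"
    unfolding exponent_log_def img e_def[symmetric] r by (intro the_equality) auto
  then have "e dvd ?p ^ 1"
    unfolding r using le by (intro le_imp_power_dvd) simp
  moreover have "Aut.ord (t x) dvd e" using e by (auto simp: Aut.pow_eq_id[OF t_Aut])
  ultimately show ?thesis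
    unfolding Aut.pow_eq_id[OF t_Aut] by (metis dvd_trans power_one_right)
qed

end

section \<open>The subgroups of the semilinear group\<close>

lemma vector_4_nth:
  "(vector [x, y, z, w] :: 'a::zero ^ 4) $ 1 = x"
  "(vector [x, y, z, w] :: 'a ^ 4) $ 2 = y"
  "(vector [x, y, z, w] :: 'a ^ 4) $ 3 = z"
  "(vector [x, y, z, w] :: 'a ^ 4) $ 4 = w"
  unfolding vector_def by simp_all

lemma E_mat_row_4:
  "E_mat a b c s $ 4 $ 1 = a" "E_mat a b c s $ 4 $ 2 = b" "E_mat a b c s $ 4 $ 3 = c"
  by (simp_all add: E_mat_def vector_4_nth)

text \<open>The last row of an \<open>E_mat\<close> holds its parameters, so these entries identify
  the parameters of a product.\<close>

lemma E_mat_mult_row_4: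
  assumes "\<sigma> \<in> carrier field_Aut"
  shows "(map_matrix \<sigma> (E_mat a b 0 s) ** E_mat x y 0 r) $ 4 $ 1 = \<sigma> a + x"
    and "(map_matrix \<sigma> (E_mat a b 0 s) ** E_mat x y 0 r) $ 4 $ 2 = \<sigma> b + y"
    and "(map_matrix \<sigma> (E_mat a b 0 s) ** E_mat x y 0 r) $ 4 $ 3 = 0"
  by (simp_all add: matrix_matrix_mult_def sum_4 E_mat_def vector_4_nth
      field_Aut_0[OF assms] field_AutD(2)[OF assms])

lemma theta_twisted:
  assumes Aut: "\<And>a b c. \<theta> a b c \<in> carrier field_Aut"
    and closed: "\<And>g h. g \<in> G_set T \<theta> \<Longrightarrow> h \<in> G_set T \<theta> \<Longrightarrow> g \<circ>\<^sub>s h \<in> G_set T \<theta>"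
  shows "\<theta> (\<theta> x y 0 a + x) (\<theta> x y 0 b + y) 0 = \<theta> a b 0 \<otimes>\<^bsub>field_Aut\<^esub> \<theta> x y 0"
proof -
  have "g_elem T \<theta> a b 0 \<circ>\<^sub>s g_elem T \<theta> x y 0 \<in> G_set T \<theta>"
    by (rule closed) (auto simp: G_set_def)
  then obtain a' b' c' where eq: "g_elem T \<theta> a b 0 \<circ>\<^sub>s g_elem T \<theta> x y 0 = g_elem T \<theta> a' b' c'"
    by (auto simp: G_set_def)
  have M: "map_matrix (\<theta> x y 0) (E_mat a b 0 (T a b 0)) ** E_mat x y 0 (T x y 0)
      = E_mat a' b' c' (T a' b' c')"
    and \<theta>: "\<theta> a b 0 \<otimes>\<^bsub>field_Aut\<^esub> \<theta> x y 0 = \<theta> a' b' c'"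
    using eq by (auto simp: g_elem_def semi_mult_def)
  have "a' = \<theta> x y 0 a + x" "b' = \<theta> x y 0 b + y" "c' = 0"
    using E_mat_mult_row_4[OF Aut, of x y 0 a b "T a b 0" x y "T x y 0"]
    unfolding M E_mat_row_4 by auto
  then show ?thesis by (simp add: \<theta>)
qed

theorem theorem5p5:
  fixes p m :: nat
    and T :: "'a::finite_field \<Rightarrow> 'a \<Rightarrow> 'a \<Rightarrow> 'a"
    and \<theta> :: "'a \<Rightarrow> 'a \<Rightarrow> 'a \<Rightarrow> 'a \<Rightarrow> 'a"
    and g\<^sub>2 :: "'a \<Rightarrow> 'a"
  assumes "prime p"
    and "CARD('a) = p ^ m"
    and "\<And>a b c. \<theta> a b c \<in> carrier field_Aut"
    and "\<And>g h. g \<in> G_set T \<theta> \<Longrightarrow> h \<in> G_set T \<theta> \<Longrightarrow> g \<circ>\<^sub>s h \<in> G_set T \<theta>"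
    and "\<exists>a b c. \<theta> a b c \<noteq> \<one>\<^bsub>field_Aut\<^esub>"
    and "g\<^sub>2 \<in> carrier field_Aut"
    and "group.ord field_Aut g\<^sub>2 = p"
  shows "(exponent_log p (G_A T \<theta>) \<le> 1 \<longrightarrow>
           (\<exists>\<mu>\<^sub>A. g\<^sub>2 \<mu>\<^sub>A = \<mu>\<^sub>A \<and>
             (\<forall>x. \<theta> x 0 0 = g\<^sub>2 [^]\<^bsub>field_Aut\<^esub> prime_field_rep (field_tr p m (\<mu>\<^sub>A * x))))) \<and>
         (exponent_log p (G_B T \<theta>) \<le> 1 \<longrightarrow>
           (\<exists>\<mu>\<^sub>B. g\<^sub>2 \<mu>\<^sub>B = \<mu>\<^sub>B \<and>
             (\<forall>x. \<theta> 0 x 0 = g\<^sub>2 [^]\<^bsub>field_Aut\<^esub> prime_field_rep (field_tr p m (\<mu>\<^sub>B * x)))))"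
proof -
  have p: "CHAR('a) = p"
    using assms(1,2) by (rule CHAR_eq_if_CARD_eq_prime_power)
  note twisted = theta_twisted[OF assms(3,4)]
  \<comment> \<open>Automorphisms fix 0, so the vanishing second parameter stays 0 in the
    product.\<close>
  interpret A: twisted_hom "\<lambda>x. \<theta> x 0 0"
    using twisted[where b = 0 and y = 0] assms(3)
    by unfold_locales (simp_all add: field_Aut_0[OF assms(3)])
  interpret B: twisted_hom "\<lambda>x. \<theta> 0 x 0"
    using twisted[where a = 0 and x = 0] assms(3)
    by unfold_locales (simp_all add: field_Aut_0[OF assms(3)])
  have "psi ` G_A T \<theta> = range (\<lambda>x. \<theta> x 0 0)" "psi ` G_B T \<theta> = range (\<lambda>x. \<theta> 0 x 0)"
    by (auto simp: psi_def G_A_def G_B_def g_elem_def image_iff)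
  then show ?thesis
    using A.t_eq_pow_field_tr[of m g\<^sub>2] A.t_pow_CHAR_if_exponent_log_le_1[of m "G_A T \<theta>"]
      B.t_eq_pow_field_tr[of m g\<^sub>2] B.t_pow_CHAR_if_exponent_log_le_1[of m "G_B T \<theta>"]
      assms(2,6,7)
    unfolding p by blast
qed

end
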